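(* Let $m\ge1$. If $B$ and $B'$ are $m$-level rook equivalent Ferrers boards, then $r_{k,m}(B;q)=r_{k,m}(B';q)$ for every integer $k\ge0$.
   Context: Fix an integer $m\ge 1$. A Ferrers board $B=(b_1,\dots,b_n)$, with integers $0\le b_1\le\dots\le b_n$, is the set of cells $(i,j)$ with $1\le i\le n$, $1\le j\le b_i$ ($i$ is the column, counted left to right; $j$ is the row, counted bottom to top). Level $p$ ($p\ge 1$) of $B$ consists of its cells in rows $(p-1)m+1,\dots,pm$. An $m$-level rook placement of $k$ rooks on $B$ is a set of $k$ cells of $B$, no two in the same column or the same level; $r_{k,m}(B)$ is the number of these. $B,B'$ are $m$-level rook equivalent if $r_{k,m}(B)=r_{k,m}(B')$ for all $k\ge0$. For an $m$-level rook placement $\pi$ on $B$, the $m$-inversion number $\mathrm{inv}_m(\pi)$ is the number of cells $c$ of $B$ such that $c$ contains no rook, there is no rook above $c$ in the same column, and there is no rook to the left of $c$ in the same level. Define $r_{k,m}(B;q)=\sum_\pi q^{\mathrm{inv}_m(\pi)}$, the sum over all $m$-level rook placements $\pi$ of $k$ rooks on $B$. *)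

theory Defs
  imports "HOL-Computational_Algebra.Polynomial"
begin

definition ferrers_board :: "nat list \<Rightarrow> bool" where
  "ferrers_board B \<longleftrightarrow> sorted B"

text \<open>A cell is a pair (column, row), both numbered from 1; lists are indexed from 0.\<close>

definition cells :: "nat list \<Rightarrow> (nat \<times> nat) set" where
  "cells B = {(i, j). 1 \<le> i \<and> i \<le> length B \<and> 1 \<le> j \<and> j \<le> B ! (i - 1)}"

text \<open>For \<open>m \<ge> 1\<close> and \<open>j \<ge> 1\<close> this is the unique \<open>p \<ge> 1\<close> with
  \<open>(p - 1) * m + 1 \<le> j \<le> p * m\<close>.\<close>

definition row_level :: "nat \<Rightarrow> nat \<Rightarrow> nat" where
  "row_level m j = (j - 1) div m + 1"

definition rook_placements :: "nat \<Rightarrow> nat \<Rightarrow> nat list \<Rightarrow> (nat \<times> nat) set set" where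
  "rook_placements m k B = {P. P \<subseteq> cells B \<and> card P = k \<and>
     (\<forall>c\<in>P. \<forall>d\<in>P. c \<noteq> d \<longrightarrow>
        fst c \<noteq> fst d \<and> row_level m (snd c) \<noteq> row_level m (snd d))}"

definition rook_number :: "nat \<Rightarrow> nat \<Rightarrow> nat list \<Rightarrow> nat" where
  "rook_number m k B = card (rook_placements m k B)"

definition rook_equivalent :: "nat \<Rightarrow> nat list \<Rightarrow> nat list \<Rightarrow> bool" where
  "rook_equivalent m B B' \<longleftrightarrow> (\<forall>k. rook_number m k B = rook_number m k B')"

definition inv_number :: "nat \<Rightarrow> nat list \<Rightarrow> (nat \<times> nat) set \<Rightarrow> nat" where
  "inv_number m B P = card {(i, j). (i, j) \<in> cells B \<and> (i, j) \<notin> P \<and>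
     \<not> (\<exists>j'. j < j' \<and> (i, j') \<in> P) \<and>
     \<not> (\<exists>i' j'. i' < i \<and> row_level m j' = row_level m j \<and> (i', j') \<in> P)}"

text \<open>The indeterminate \<open>q\<close> is the variable of the polynomial ring over the integers.\<close>

definition q_rook_number :: "nat \<Rightarrow> nat \<Rightarrow> nat list \<Rightarrow> int poly" where
  "q_rook_number m k B = (\<Sum>P\<in>rook_placements m k B. monom 1 (inv_number m B P))"

lemma finite_cells: "finite (cells B)"
proof -
  have "cells B \<subseteq> {..length B} \<times> {..Max (set B)}"
    by (auto simp: cells_def intro!: order_trans[OF _ Max_ge])
  then show ?thesis
    by (rule finite_subset) simp
qed

lemma finite_rook_placements: "finite (rook_placements m k B)"
  by (rule finite_subset[of _ "Pow (cells B)"])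
     (auto simp: rook_placements_def finite_cells)

lemma row_level_eq_iff:
  assumes "1 \<le> m" "1 \<le> j" "1 \<le> p"
  shows "row_level m j = p \<longleftrightarrow> (p - 1) * m + 1 \<le> j \<and> j \<le> p * m"
proof -
  obtain p' j' where [simp]: "p = Suc p'" "j = Suc j'"
    using assms by (metis Suc_le_D One_nat_def)
  have "j' div m = p' \<longleftrightarrow> p' * m \<le> j' \<and> j' < Suc p' * m"
    using assms div_less_iff_less_mult[of m j' "Suc p'"] less_eq_div_iff_mult_less_eq[of m p' j']
    by linarith
  then show ?thesis
    by (auto simp: row_level_def)
qed

end

theory Submission
  imports Defs
begin

text \<open>
  Group the columns of a board into zones, a zone consisting of the columns \<open>b = p * m + r\<close>
  with a common \<open>p = b div m\<close>. Only the partial level \<open>p + 1\<close> of a zone distinguishes its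
  columns from columns of height \<open>p * m\<close>. Inserting columns from left to right, one finds that
  the \<open>q\<close>-rook numbers do not change if all remainders of the zone are formally moved to its last
  column. For the resulting heights \<open>c\<^sub>1, \<dots>, c\<^sub>n\<close> the number of cells left free in column
  \<open>i\<close> by \<open>k\<close> rooks is \<open>c\<^sub>i - k * m\<close>, which gives the Goldman-Joichi-White type factorization
  \<open>\<Sum>\<^sub>k r\<^sub>k(q) [x] [x - m] \<cdots> [x - (n - k - 1) m] = \<Prod>\<^sub>i [x + c\<^sub>i - (i - 1) m]\<close> with \<open>q\<close>-integers
  \<open>[z]\<close>. At \<open>q = 1\<close> the left-hand side determines the multiset of the numbers
  \<open>c\<^sub>i - (i - 1) m\<close>; this multiset determines the right-hand side for all \<open>q\<close>, and hence all \<open>r\<^sub>k(q)\<close>.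
  Columns of height zero make the lengths of the two boards equal.
\<close>

section \<open>q-integers\<close>

text \<open>The quotient degenerates at \<open>q = 1\<close>, where its limit \<open>z\<close> is
  substituted, so that the classical and the q-case share all later lemmas. The argument is an
  integer because heights minus multiples of \<open>m\<close> can be negative.\<close>

definition q_int :: "real \<Rightarrow> int \<Rightarrow> real" where
  "q_int q z = (if q = 1 then of_int z else (q powi z - 1) / (q - 1))"

lemma q_int_0 [simp]: "q_int q 0 = 0"
  by (simp add: q_int_def)

lemma q_int_add: "q \<noteq> 0 \<Longrightarrow> q_int q (a + b) = q_int q a + q powi a * q_int q b"
  by (simp add: q_int_def power_int_add divide_simps) (simp add: algebra_simps)

lemma q_int_pos: "1 \<le> q \<Longrightarrow> 0 < z \<Longrightarrow> 0 < q_int q z"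
  by (cases "q = 1")
     (auto simp: q_int_def intro!: divide_pos_pos power_int_strict_increasing[of 0 z q, simplified])

text \<open>The exponents run through 0, ..., \<open>card A - 1\<close>, a geometric sum. This is
  the weight of all rook positions in a column with free cells \<open>A\<close>: exactly the free
  cells above the rook are inversions.\<close>

lemma sum_power_card_greater:
  fixes A :: "nat set"
  assumes "finite A" and "q \<noteq> 0"
  shows "(\<Sum>j\<in>A. q ^ card {i\<in>A. j < i}) = q_int q (int (card A))"
  using assms(1)
proof (induction A rule: finite_linorder_min_induct)
  case empty
  show ?case by simp
next
  case (insert b A)
  have nin: "b \<notin> A" using insert by auto
  have 1: "{i \<in> insert b A. b < i} = A" using insert by auto
  have 2: "{i \<in> insert b A. j < i} = {i \<in> A. j < i}" if "j \<in> A" for j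
    using insert that by auto
  have "(\<Sum>j\<in>insert b A. q ^ card {i\<in>insert b A. j < i}) = q ^ card A + q_int q (int (card A))"
    unfolding sum.insert[OF insert.hyps(1) nin] 1 using insert.IH 2 by simp
  also have "\<dots> = q_int q (int (card A) + 1)"
    unfolding q_int_add[OF assms(2)] by (simp add: q_int_def)
  finally show ?case using insert nin by (simp add: add.commute)
qed

section \<open>Inserting a rightmost column\<close>

definition levels :: "nat \<Rightarrow> (nat \<times> nat) set \<Rightarrow> nat set" where
  "levels m P = (\<lambda>c. row_level m (snd c)) ` P"

text \<open>These are the cells of a new rightmost column that no earlier rook cancels. The set
  serves both as the admissible rook positions and as the candidates for inversions.\<close>

definition avail :: "nat \<Rightarrow> nat \<Rightarrow> nat set \<Rightarrow> nat set" where
  "avail m b L = {j \<in> {1..b}. row_level m j \<notin> L}"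

lemma finite_avail [simp]: "finite (avail m b L)"
  by (simp add: avail_def)

lemma cells_snoc: "cells (B @ [b]) = cells B \<union> Pair (Suc (length B)) ` {1..b}"
proof (intro set_eqI, clarify)
  fix i j
  consider "i = Suc (length B)" | "i > Suc (length B)" | "i = 0" | "1 \<le> i" "i \<le> length B" by linarith
  then show "(i, j) \<in> cells (B @ [b]) \<longleftrightarrow> (i, j) \<in> cells B \<union> Pair (Suc (length B)) ` {1..b}"
    by cases (auto simp: cells_def nth_append)
qed

lemma fst_cells_le: "(i, j) \<in> cells B \<Longrightarrow> i \<le> length B"
  by (simp add: cells_def)

text \<open>A rook affects only cells below it and cells to its right, so the old cells keep their
  status; in the empty last column every uncancelled cell is an inversion.\<close>

lemma inv_number_snoc_no_rook:
  assumes P: "P \<subseteq> cells B"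
  shows "inv_number m (B @ [b]) P = inv_number m B P + card (avail m b (levels m P))"
proof -
  let ?n = "Suc (length B)"
  let ?I = "\<lambda>B P. {(i, j). (i, j) \<in> cells B \<and> (i, j) \<notin> P \<and>
     \<not> (\<exists>j'. j < j' \<and> (i, j') \<in> P) \<and>
     \<not> (\<exists>i' j'. i' < i \<and> row_level m j' = row_level m j \<and> (i', j') \<in> P)}"
  have *: "(i, j) \<in> P \<Longrightarrow> i < ?n" for i j
    using P by (auto simp: cells_def)
  have "?I (B @ [b]) P = ?I B P \<union> Pair ?n ` avail m b (levels m P)"
  proof (intro set_eqI, clarify)
    fix x y
    show "(x, y) \<in> ?I (B @ [b]) P \<longleftrightarrow> (x, y) \<in> ?I B P \<union> Pair ?n ` avail m b (levels m P)"
    proof (cases "x = ?n")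
      case True
      have "(x, z) \<notin> P" "(x, z) \<notin> cells B" for z
        using *[of x z] fst_cells_le[of x z B] True by auto
      moreover have "row_level m y \<in> levels m P \<longleftrightarrow>
          (\<exists>i' j'. i' < x \<and> row_level m j' = row_level m y \<and> (i', j') \<in> P)"
        using * True unfolding levels_def by force
      ultimately show ?thesis using True unfolding cells_snoc avail_def by auto
    next
      case False
      then show ?thesis unfolding cells_snoc by auto
    qed
  qed
  moreover have "?I B P \<inter> Pair ?n ` avail m b (levels m P) = {}"
    by (auto simp: cells_def)
  moreover have "finite (?I B P)"
    by (rule finite_subset[OF _ finite_cells[of B]]) auto
  ultimately have "card (?I (B @ [b]) P) = card (?I B P) + card (Pair ?n ` avail m b (levels m P))"
    by (simp only: card_Un_disjoint finite_imageI finite_avail)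
  also have "card (Pair ?n ` avail m b (levels m P)) = card (avail m b (levels m P))"
    by (rule card_image) (simp add: inj_on_def)
  finally show ?thesis
    unfolding inv_number_def .
qed

text \<open>The new rook has no column to its right, so it removes only its own cell and the cells
  below it from the count.\<close>

lemma inv_number_snoc_rook:
  assumes P: "P \<subseteq> cells B" and j: "j \<in> avail m b (levels m P)"
  shows "inv_number m (B @ [b]) (insert (Suc (length B), j) P) =
    inv_number m B P + card {i \<in> avail m b (levels m P). j < i}"
proof -
  let ?n = "Suc (length B)"
  let ?I = "\<lambda>B P. {(i, j). (i, j) \<in> cells B \<and> (i, j) \<notin> P \<and>
     \<not> (\<exists>j'. j < j' \<and> (i, j') \<in> P) \<and>
     \<not> (\<exists>i' j'. i' < i \<and> row_level m j' = row_level m j \<and> (i', j') \<in> P)}"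
  let ?A = "{i \<in> avail m b (levels m P). j < i}"
  have *: "(i, j) \<in> P \<Longrightarrow> i < ?n" for i j
    using P by (auto simp: cells_def)
  have "?I (B @ [b]) (insert (?n, j) P) = ?I B P \<union> Pair ?n ` ?A"
  proof (intro set_eqI, clarify)
    fix x y
    show "(x, y) \<in> ?I (B @ [b]) (insert (?n, j) P) \<longleftrightarrow> (x, y) \<in> ?I B P \<union> Pair ?n ` ?A"
    proof (cases "x = ?n")
      case True
      have nP: "(x, z) \<notin> P" "(x, z) \<notin> cells B" for z
        using *[of x z] fst_cells_le[of x z B] True by auto
      have e1: "(\<exists>i' j'. i' < x \<and> row_level m j' = row_level m y \<and> (i', j') \<in> insert (?n, j) P)
          \<longleftrightarrow> row_level m y \<in> levels m P"
        using * True unfolding levels_def by force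
      have e2: "(\<exists>j'. y < j' \<and> (x, j') \<in> insert (?n, j) P) \<longleftrightarrow> y < j"
        "(x, y) \<in> insert (?n, j) P \<longleftrightarrow> y = j"
        using nP True by auto
      have e3: "(x, y) \<in> cells (B @ [b]) \<longleftrightarrow> y \<in> {1..b}"
        using nP True by (auto simp: cells_snoc)
      have e4: "(x, y) \<in> ?I B P \<union> Pair ?n ` ?A \<longleftrightarrow> y \<in> ?A"
        using nP True by auto
      show ?thesis
        unfolding e4 unfolding mem_Collect_eq case_prod_conv e1 e2 e3 by (auto simp: avail_def)
    next
      case False
      have e1: "(x, y) \<in> cells (B @ [b]) \<longleftrightarrow> (x, y) \<in> cells B"
        "(x, z) \<in> insert (?n, j) P \<longleftrightarrow> (x, z) \<in> P" for z
        using False by (auto simp: cells_snoc)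
      have e2: "(i', j') \<in> insert (?n, j) P \<longleftrightarrow> (i', j') \<in> P"
        if "(x, y) \<in> cells B" "i' < x" for i' j'
        using fst_cells_le[OF that(1)] that(2) by auto
      have e3: "(x, y) \<in> ?I B P \<union> Pair ?n ` ?A \<longleftrightarrow> (x, y) \<in> ?I B P"
        using False by blast
      show ?thesis
        unfolding e3 unfolding mem_Collect_eq case_prod_conv e1 using e2 by blast
    qed
  qed
  moreover have "?I B P \<inter> Pair ?n ` ?A = {}"
    by (auto simp: cells_def)
  moreover have "finite (?I B P)"
    by (rule finite_subset[OF _ finite_cells[of B]]) auto
  ultimately have "card (?I (B @ [b]) (insert (?n, j) P)) = card (?I B P) + card (Pair ?n ` ?A)"
    by (simp only: card_Un_disjoint finite_imageI finite_Collect_conjI finite_avail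
          Collect_mem_eq simp_thms)
  also have "card (Pair ?n ` ?A) = card (?A)"
    by (rule card_image) (simp add: inj_on_def)
  finally show ?thesis
    unfolding inv_number_def .
qed

lemma rook_placementsD:
  assumes "P \<in> rook_placements m k B"
  shows "P \<subseteq> cells B" "finite P" "card P = k" "card (levels m P) = k"
proof -
  show 1: "P \<subseteq> cells B" "card P = k" using assms by (auto simp: rook_placements_def)
  show "finite P" using 1 finite_cells finite_subset by blast
  have "inj_on (\<lambda>c. row_level m (snd c)) P"
    using assms by (fastforce simp: rook_placements_def inj_on_def)
  then show "card (levels m P) = k" using 1 by (simp add: levels_def card_image)
qed

lemma rook_placements_insert:
  assumes "P \<in> rook_placements m k B" and "j \<in> avail m b (levels m P)"
  shows "insert (Suc (length B), j) P \<in> rook_placements m (Suc k) (B @ [b])"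
proof -
  have P: "P \<subseteq> cells B" "finite P" "card P = k" using rook_placementsD[OF assms(1)] by auto
  then have new: "c \<in> P \<Longrightarrow> fst c \<noteq> Suc (length B)" for c
    using fst_cells_le[of "fst c" "snd c" B] by auto
  have lev: "c \<in> P \<Longrightarrow> row_level m (snd c) \<noteq> row_level m j" for c
    using assms(2) by (force simp: avail_def levels_def)
  have pairs: "fst c \<noteq> fst d \<and> row_level m (snd c) \<noteq> row_level m (snd d)"
    if "c \<in> P" "d \<in> P" "c \<noteq> d" for c d
    using assms(1) that by (auto simp: rook_placements_def)
  have "(Suc (length B), j) \<notin> P" using new by force
  then show ?thesis using P assms(2) unfolding rook_placements_def cells_snoc mem_Collect_eq
    by (intro conjI ballI impI) (auto simp: avail_def dest: new lev lev[symmetric] pairs)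
qed

lemma rook_placements_snoc_cases:
  assumes "P \<in> rook_placements m k (B @ [b])"
  obtains "P \<in> rook_placements m k B"
  | k' P' j where "k = Suc k'" "P' \<in> rook_placements m k' B"
      "j \<in> avail m b (levels m P')" "P = insert (Suc (length B), j) P'"
proof (cases "P \<subseteq> cells B")
  case True
  then show ?thesis using assms that(1) by (auto simp: rook_placements_def)
next
  case False
  note P = rook_placementsD[OF assms]
  let ?n = "Suc (length B)"
  obtain j where j: "(?n, j) \<in> P" "1 \<le> j" "j \<le> b"
    using False P(1) unfolding cells_snoc by fastforce
  define P' where "P' = P - {(?n, j)}"
  have diff: "fst c \<noteq> ?n \<and> row_level m (snd c) \<noteq> row_level m j" if "c \<in> P'" for c
    using assms j that unfolding P'_def rook_placements_def by fastforce
  have PP: "P = insert (?n, j) P'" using j by (auto simp: P'_def)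
  have "k = Suc (card P')" using P j by (metis P'_def card_Suc_Diff1)
  moreover have "P' \<subseteq> cells B" using P(1) diff by (force simp: P'_def cells_snoc)
  then have "P' \<in> rook_placements m (card P') B"
    using assms by (auto simp: rook_placements_def P'_def)
  moreover have "j \<in> avail m b (levels m P')"
    using j diff by (fastforce simp: avail_def levels_def)
  ultimately show ?thesis using PP that(2) by blast
qed

section \<open>Weighted sums over placements\<close>

text \<open>The weight \<open>g\<close> lets one recursion serve both the full sum (\<open>g\<close>
  constant 1) and the sums restricted by whether a given level is occupied.\<close>

definition wsum :: "nat \<Rightarrow> real \<Rightarrow> nat \<Rightarrow> nat list \<Rightarrow> (nat set \<Rightarrow> real) \<Rightarrow> real" where
  "wsum m q k B g = (\<Sum>P\<in>rook_placements m k B. g (levels m P) * q ^ inv_number m B P)"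

lemma rook_placements_snoc:
  "rook_placements m k (B @ [b]) = rook_placements m k B \<union>
    (case k of 0 \<Rightarrow> {} | Suc k' \<Rightarrow> (\<lambda>(P, j). insert (Suc (length B), j) P) `
       (SIGMA P:rook_placements m k' B. avail m b (levels m P)))" (is "_ = ?R")
proof
  show "rook_placements m k (B @ [b]) \<subseteq> ?R"
    by (rule subsetI, erule rook_placements_snoc_cases) (force+)
  show "?R \<subseteq> rook_placements m k (B @ [b])"
  proof (intro Un_least)
    show "rook_placements m k B \<subseteq> rook_placements m k (B @ [b])"
      unfolding rook_placements_def cells_snoc by blast
  qed (auto split: nat.splits intro: rook_placements_insert)
qed

text \<open>The first sum collects the placements with empty last column; in the second, removing
  the rook of that column recovers \<open>P\<close> and \<open>j\<close> uniquely.\<close>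

lemma wsum_snoc:
  "wsum m q k (B @ [b]) g =
    (\<Sum>P\<in>rook_placements m k B. g (levels m P) * q ^ inv_number m B P *
         q ^ card (avail m b (levels m P))) +
    (case k of 0 \<Rightarrow> 0 | Suc k' \<Rightarrow> \<Sum>P\<in>rook_placements m k' B. q ^ inv_number m B P *
       (\<Sum>j\<in>avail m b (levels m P). g (insert (row_level m j) (levels m P)) *
          q ^ card {i\<in>avail m b (levels m P). j < i}))"
proof -
  let ?n = "Suc (length B)"
  let ?f = "\<lambda>P. g (levels m P) * q ^ inv_number m (B @ [b]) P"
  have old: "sum ?f (rook_placements m k B) =
      (\<Sum>P\<in>rook_placements m k B. g (levels m P) * q ^ inv_number m B P *
         q ^ card (avail m b (levels m P)))"
    by (rule sum.cong) (auto simp: inv_number_snoc_no_rook rook_placementsD(1) power_add)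
  show ?thesis
  proof (cases k)
    case 0
    then show ?thesis using old by (simp add: wsum_def rook_placements_snoc)
  next
    case (Suc k')
    let ?S = "SIGMA P:rook_placements m k' B. avail m b (levels m P)"
    let ?h = "\<lambda>(P, j). insert (?n, j) P"
    have notin: "(?n, j) \<notin> P" if "P \<in> rook_placements m l B" for P j l
      using rook_placementsD(1)[OF that] fst_cells_le[of ?n j B] by auto
    have inj: "inj_on ?h ?S"
    proof (rule inj_onI, clarify)
      fix P j P' j'
      assume *: "P \<in> rook_placements m k' B" "P' \<in> rook_placements m k' B"
        "insert (?n, j) P = insert (?n, j') P'"
      have "(?n, j) \<in> insert (?n, j') P'" using *(3) by blast
      then have "j = j'" using notin[OF *(2)] by auto
      then show "P = P' \<and> j = j'" using * notin insert_ident by metis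
    qed
    have disj: "rook_placements m k B \<inter> ?h ` ?S = {}"
      using notin by force
    have fin: "finite ?S" by (simp add: finite_rook_placements)
    have "wsum m q k (B @ [b]) g = sum ?f (rook_placements m k B) + sum ?f (?h ` ?S)"
      unfolding wsum_def rook_placements_snoc Suc nat.case
      using disj fin by (subst sum.union_disjoint) (auto simp: finite_rook_placements Suc)
    also have "sum ?f (?h ` ?S) = (\<Sum>(P, j)\<in>?S. ?f (insert (?n, j) P))"
      by (subst sum.reindex[OF inj]) (simp add: case_prod_unfold)
    also have "\<dots> = (\<Sum>P\<in>rook_placements m k' B. \<Sum>j\<in>avail m b (levels m P). ?f (insert (?n, j) P))"
      by (rule sum.Sigma[symmetric]) (auto simp: finite_rook_placements)
    also have "\<dots> = (\<Sum>P\<in>rook_placements m k' B. q ^ inv_number m B P *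
       (\<Sum>j\<in>avail m b (levels m P). g (insert (row_level m j) (levels m P)) *
          q ^ card {i\<in>avail m b (levels m P). j < i}))"
      unfolding sum_distrib_left
      by (intro sum.cong refl)
         (simp add: inv_number_snoc_rook rook_placementsD(1) power_add levels_def mult_ac)
    finally show ?thesis using old Suc by simp
  qed
qed

section \<open>Free cells of a column, level by level\<close>

lemma card_avail_full_levels:
  assumes m: "1 \<le> m"
  shows "int (card (avail m (p * m) L)) = (int p - int (card (L \<inter> {1..p}))) * int m"
proof (induction p)
  case 0
  show ?case by (simp add: avail_def)
next
  case (Suc p)
  let ?blk = "{p * m + 1..Suc p * m}"
  have lev: "j \<in> ?blk \<Longrightarrow> row_level m j = Suc p" for j
    using row_level_eq_iff[OF m, of j "Suc p"] by auto
  have split: "{1..Suc p * m} = {1..p * m} \<union> ?blk" by auto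
  have "avail m (Suc p * m) L = avail m (p * m) L \<union> (if Suc p \<in> L then {} else ?blk)"
    unfolding avail_def split using lev by auto
  moreover have "avail m (p * m) L \<inter> ?blk = {}" by (auto simp: avail_def)
  ultimately have "card (avail m (Suc p * m) L) = card (avail m (p * m) L) + (if Suc p \<in> L then 0 else m)"
    by (simp add: card_Un_disjoint)
  moreover have "L \<inter> {1..Suc p} = (if Suc p \<in> L then insert (Suc p) (L \<inter> {1..p}) else L \<inter> {1..p})"
    by (auto simp: le_Suc_eq)
  ultimately show ?case using Suc.IH by (simp add: algebra_simps)
qed

lemma levels_bound:
  assumes m: "1 \<le> m" and "P \<in> rook_placements m k B" and "\<forall>x\<in>set B. x \<le> p * m"
  shows "levels m P \<subseteq> {1..p}"
proof -
  have "row_level m j \<in> {1..p}" if "(i, j) \<in> P" for i j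
  proof -
    have "(i, j) \<in> cells B" using assms rook_placementsD(1) that by blast
    then have "1 \<le> j" "j \<le> p * m"
      using assms(3) by (auto simp: cells_def intro: order_trans)
    then have "j - 1 < p * m" by auto
    then show ?thesis using m by (simp add: row_level_def less_mult_imp_div_less Suc_le_eq)
  qed
  then show ?thesis by (auto simp: levels_def)
qed

context
  fixes m p r :: nat and L :: "nat set"
  assumes m: "1 \<le> m" and r: "r \<le> m"
begin

lemma row_level_top: "j \<in> {p * m + 1..p * m + r} \<Longrightarrow> row_level m j = Suc p"
  using row_level_eq_iff[OF m, of j "Suc p"] r by auto

lemma row_level_low: "j \<in> {1..p * m} \<Longrightarrow> row_level m j \<noteq> Suc p"
  using row_level_eq_iff[OF m, of j "Suc p"] r by auto

lemma avail_top_free: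
  "Suc p \<notin> L \<Longrightarrow> avail m (p * m + r) L = avail m (p * m) L \<union> {p * m + 1..p * m + r}"
  using row_level_top by (auto simp: avail_def)

lemma avail_top_used:
  "Suc p \<in> L \<Longrightarrow> avail m (p * m + r) L = avail m (p * m) L"
proof -
  assume "Suc p \<in> L"
  then have "j \<le> p * m" if "j \<in> avail m (p * m + r) L" for j
    using row_level_top[of j] that by (cases "j \<le> p * m") (auto simp: avail_def)
  then show ?thesis by (auto simp: avail_def)
qed

lemma card_avail_top_free:
  "Suc p \<notin> L \<Longrightarrow> card (avail m (p * m + r) L) = r + card (avail m (p * m) L)"
  unfolding avail_top_free by (subst card_Un_disjoint) (auto simp: avail_def)

text \<open>The indicator forces the rook into a full level. All \<open>r\<close> cells of the
  partial level then lie above it and are inversions, whence the factor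
  \<open>q ^ r\<close>.\<close>

lemma sum_avail_low:
  assumes "Suc p \<notin> L" and q: "q \<noteq> 0"
  shows "(\<Sum>j\<in>avail m (p * m + r) L. of_bool (Suc p \<notin> insert (row_level m j) L) *
     q ^ card {i\<in>avail m (p * m + r) L. j < i}) = q ^ r * q_int q (int (card (avail m (p * m) L)))"
proof -
  let ?A = "avail m (p * m) L" and ?T = "{p * m + 1..p * m + r}"
  have AT: "?A \<inter> ?T = {}" by (auto simp: avail_def)
  have top: "row_level m j = Suc p" if "j \<in> ?T" for j using that by (rule row_level_top)
  have low: "row_level m j \<noteq> Suc p" if "j \<in> ?A" for j using that row_level_low by (auto simp: avail_def)
  have c: "card {i \<in> ?A \<union> ?T. j < i} = r + card {i \<in> ?A. j < i}" if "j \<in> ?A" for j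
  proof -
    have "{i \<in> ?A \<union> ?T. j < i} = ?T \<union> {i \<in> ?A. j < i}" using that by (auto simp: avail_def)
    moreover have "?T \<inter> {i \<in> ?A. j < i} = {}" using AT by auto
    ultimately show ?thesis by (simp only: card_Un_disjoint) (simp add: card_Un_disjoint)
  qed
  have "(\<Sum>j\<in>?T. of_bool (Suc p \<notin> insert (row_level m j) L) * q ^ card {i \<in> ?A \<union> ?T. j < i}) = 0"
    by (intro sum.neutral ballI) (use top in simp)
  moreover have "(\<Sum>j\<in>?A. of_bool (Suc p \<notin> insert (row_level m j) L) * q ^ card {i \<in> ?A \<union> ?T. j < i})
     = (\<Sum>j\<in>?A. q ^ r * q ^ card {i\<in>?A. j < i})"
  proof (rule sum.cong[OF refl])
    fix j assume "j \<in> ?A"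
    then show "of_bool (Suc p \<notin> insert (row_level m j) L) * q ^ card {i \<in> ?A \<union> ?T. j < i}
      = q ^ r * q ^ card {i\<in>?A. j < i}"
      using low[of j] assms unfolding c[OF \<open>j \<in> ?A\<close>] by (simp add: power_add)
  qed
  ultimately show ?thesis
    unfolding avail_top_free[OF assms(1)] sum_power_card_greater[OF finite_avail q, symmetric]
      sum_distrib_left
    by (subst sum.union_disjoint) (use AT in auto)
qed

text \<open>The indicator forces the rook into the partial level. Only cells of that level can lie
  above it, so the full levels do not contribute.\<close>

lemma sum_avail_top:
  assumes "Suc p \<notin> L" and q: "q \<noteq> 0"
  shows "(\<Sum>j\<in>avail m (p * m + r) L. of_bool (Suc p \<in> insert (row_level m j) L) *
     q ^ card {i\<in>avail m (p * m + r) L. j < i}) = q_int q (int r)"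
proof -
  let ?A = "avail m (p * m) L" and ?T = "{p * m + 1..p * m + r}"
  have AT: "?A \<inter> ?T = {}" by (auto simp: avail_def)
  have top: "row_level m j = Suc p" if "j \<in> ?T" for j using that by (rule row_level_top)
  have low: "row_level m j \<noteq> Suc p" if "j \<in> ?A" for j using that row_level_low by (auto simp: avail_def)
  have c: "{i \<in> ?A \<union> ?T. j < i} = {i \<in> ?T. j < i}" if "j \<in> ?T" for j
    using that by (auto simp: avail_def)
  have "(\<Sum>j\<in>?T. q ^ card {i\<in>?T. j < i}) = q_int q (int r)"
    using sum_power_card_greater[OF _ q, of ?T] by simp
  moreover have "(\<Sum>j\<in>?A. of_bool (Suc p \<in> insert (row_level m j) L) * q ^ card {i \<in> ?A \<union> ?T. j < i}) = 0"
    by (intro sum.neutral ballI) (use low assms in force)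
  moreover have "(\<Sum>j\<in>?T. of_bool (Suc p \<in> insert (row_level m j) L) * q ^ card {i \<in> ?A \<union> ?T. j < i})
     = (\<Sum>j\<in>?T. q ^ card {i\<in>?T. j < i})"
    by (rule sum.cong[OF refl]) (use top c in simp)
  ultimately show ?thesis
    unfolding avail_top_free[OF assms(1)]
    by (subst sum.union_disjoint) (use AT in auto)
qed

text \<open>Once the partial level is cancelled, the column behaves like one of height
  \<open>p * m\<close>.\<close>

lemma sum_avail_used:
  assumes "Suc p \<in> L" and q: "q \<noteq> 0"
  shows "(\<Sum>j\<in>avail m (p * m + r) L. of_bool (Suc p \<in> insert (row_level m j) L) *
     q ^ card {i\<in>avail m (p * m + r) L. j < i}) = q_int q (int (card (avail m (p * m) L)))"
  using assms by (simp add: avail_top_used sum_power_card_greater q)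

end

section \<open>Recursion within a zone\<close>

text \<open>The head of the list is the rightmost column.\<close>

fun col_rook :: "real \<Rightarrow> nat \<Rightarrow> nat \<Rightarrow> int list \<Rightarrow> real" where
  "col_rook q m k [] = of_bool (k = 0)"
| "col_rook q m k (x # c) = q powi (x - int k * int m) * col_rook q m k c +
     (case k of 0 \<Rightarrow> 0 | Suc j \<Rightarrow> q_int q (x - int j * int m) * col_rook q m j c)"

text \<open>Within a zone, the number of rooks and the occupation of the partial level determine how
  many cells of the next column are free; hence these two sums suffice as state.\<close>

abbreviation wfree :: "nat \<Rightarrow> real \<Rightarrow> nat \<Rightarrow> nat \<Rightarrow> nat list \<Rightarrow> real" where
  "wfree m q p k B \<equiv> wsum m q k B (\<lambda>L. of_bool (Suc p \<notin> L))"

abbreviation wused :: "nat \<Rightarrow> real \<Rightarrow> nat \<Rightarrow> nat \<Rightarrow> nat list \<Rightarrow> real" where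
  "wused m q p k B \<equiv> wsum m q k B (\<lambda>L. of_bool (Suc p \<in> L))"

lemma wfree_plus_wused: "wfree m q p k B + wused m q p k B = wsum m q k B (\<lambda>_. 1)"
  unfolding wsum_def sum.distrib[symmetric] by (rule sum.cong) auto

context
  fixes m p r :: nat and q :: real and B :: "nat list"
  assumes m: "1 \<le> m" and r: "r \<le> m" and q: "q \<noteq> 0"
    and B: "\<forall>x\<in>set B. x \<le> Suc p * m"
begin

text \<open>Each of the \<open>k\<close> rooks cancels one of the \<open>p\<close> full
  levels.\<close>

lemma card_avail_low_free:
  assumes "P \<in> rook_placements m k B" and "Suc p \<notin> levels m P"
  shows "int (card (avail m (p * m) (levels m P))) = (int p - int k) * int m"
proof -
  have "levels m P \<inter> {1..p} = levels m P"
    using levels_bound[OF m assms(1) B] assms(2) by (auto simp: le_Suc_eq subset_iff)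
  then show ?thesis
    using card_avail_full_levels[OF m, of p "levels m P"] rook_placementsD(4)[OF assms(1)] by simp
qed

text \<open>One of the \<open>k\<close> rooks sits in the partial level, so only
  \<open>k - 1\<close> full levels are cancelled.\<close>

lemma card_avail_low_used:
  assumes "P \<in> rook_placements m k B" and "Suc p \<in> levels m P"
  shows "int (card (avail m (p * m) (levels m P))) = (int p + 1 - int k) * int m"
proof -
  have "levels m P = insert (Suc p) (levels m P \<inter> {1..p})"
    using levels_bound[OF m assms(1) B] assms(2) by (auto simp: le_Suc_eq subset_iff)
  then have "card (levels m P) = Suc (card (levels m P \<inter> {1..p}))"
    by (metis Int_iff Suc_n_not_le_n atLeastAtMost_iff card_insert_disjoint finite_Int finite_atLeastAtMost)
  then show ?thesis
    using card_avail_full_levels[OF m, of p "levels m P"] rook_placementsD(4)[OF assms(1)] by simp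
qed

text \<open>The new column is empty or has its rook in a full level; a rook in the partial level
  would leave this class.\<close>

lemma wfree_snoc:
  "wfree m q p k (B @ [p * m + r]) =
     q powi (int r + (int p - int k) * int m) * wfree m q p k B +
     (case k of 0 \<Rightarrow> 0 | Suc j \<Rightarrow> q ^ r * q_int q ((int p - int j) * int m) * wfree m q p j B)"
proof -
  let ?b = "p * m + r"
  have 1: "(\<Sum>P\<in>rook_placements m k B. of_bool (Suc p \<notin> levels m P) * q ^ inv_number m B P *
      q ^ card (avail m ?b (levels m P))) = q powi (int r + (int p - int k) * int m) * wfree m q p k B"
    unfolding wsum_def sum_distrib_left
  proof (rule sum.cong[OF refl])
    fix P assume P: "P \<in> rook_placements m k B"
    have "q ^ card (avail m ?b (levels m P)) = q powi (int r + (int p - int k) * int m)"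
      if "Suc p \<notin> levels m P"
      using card_avail_top_free[OF m r that] card_avail_low_free[OF P that]
      by (metis of_nat_add power_int_of_nat)
    then show "of_bool (Suc p \<notin> levels m P) * q ^ inv_number m B P * q ^ card (avail m ?b (levels m P)) =
        q powi (int r + (int p - int k) * int m) * (of_bool (Suc p \<notin> levels m P) * q ^ inv_number m B P)"
      by auto
  qed
  have 2: "(\<Sum>P\<in>rook_placements m j B. q ^ inv_number m B P *
       (\<Sum>j\<in>avail m ?b (levels m P). of_bool (Suc p \<notin> insert (row_level m j) (levels m P)) *
          q ^ card {i\<in>avail m ?b (levels m P). j < i})) =
      q ^ r * q_int q ((int p - int j) * int m) * wfree m q p j B" for j
    unfolding wsum_def sum_distrib_left[of "q ^ r * _"]
  proof (rule sum.cong[OF refl])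
    fix P assume P: "P \<in> rook_placements m j B"
    show "q ^ inv_number m B P *
       (\<Sum>j\<in>avail m ?b (levels m P). of_bool (Suc p \<notin> insert (row_level m j) (levels m P)) *
          q ^ card {i\<in>avail m ?b (levels m P). j < i}) =
      q ^ r * q_int q ((int p - int j) * int m) * (of_bool (Suc p \<notin> levels m P) * q ^ inv_number m B P)"
    proof (cases "Suc p \<in> levels m P")
      case True
      then show ?thesis by simp
    next
      case False
      show ?thesis
        unfolding sum_avail_low[OF m r False q] card_avail_low_free[OF P False] using False by simp
    qed
  qed
  show ?thesis
    unfolding wsum_snoc 1 2 by (rule refl)
qed

text \<open>Either the partial level was occupied before, and the new column acts like one of height
  \<open>p * m\<close>, or the new rook is the one that occupies it.\<close>

lemma wused_snoc:
  "wused m q p k (B @ [p * m + r]) =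
     q powi ((int p + 1 - int k) * int m) * wused m q p k B +
     (case k of 0 \<Rightarrow> 0 | Suc j \<Rightarrow>
        q_int q ((int p + 1 - int j) * int m) * wused m q p j B + q_int q (int r) * wfree m q p j B)"
proof -
  let ?b = "p * m + r"
  have 1: "(\<Sum>P\<in>rook_placements m k B. of_bool (Suc p \<in> levels m P) * q ^ inv_number m B P *
      q ^ card (avail m ?b (levels m P))) = q powi ((int p + 1 - int k) * int m) * wused m q p k B"
    unfolding wsum_def sum_distrib_left
  proof (rule sum.cong[OF refl])
    fix P assume P: "P \<in> rook_placements m k B"
    have "q ^ card (avail m ?b (levels m P)) = q powi ((int p + 1 - int k) * int m)"
      if "Suc p \<in> levels m P"
      using avail_top_used[OF m r that] card_avail_low_used[OF P that]
      by (metis power_int_of_nat)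
    then show "of_bool (Suc p \<in> levels m P) * q ^ inv_number m B P * q ^ card (avail m ?b (levels m P)) =
        q powi ((int p + 1 - int k) * int m) * (of_bool (Suc p \<in> levels m P) * q ^ inv_number m B P)"
      by auto
  qed
  have 2: "(\<Sum>P\<in>rook_placements m j B. q ^ inv_number m B P *
       (\<Sum>j\<in>avail m ?b (levels m P). of_bool (Suc p \<in> insert (row_level m j) (levels m P)) *
          q ^ card {i\<in>avail m ?b (levels m P). j < i})) =
      q_int q ((int p + 1 - int j) * int m) * wused m q p j B + q_int q (int r) * wfree m q p j B" for j
    unfolding wsum_def sum_distrib_left[of "q_int _ _"] sum.distrib[symmetric]
  proof (rule sum.cong[OF refl])
    fix P assume P: "P \<in> rook_placements m j B"
    show "q ^ inv_number m B P *
       (\<Sum>j\<in>avail m ?b (levels m P). of_bool (Suc p \<in> insert (row_level m j) (levels m P)) *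
          q ^ card {i\<in>avail m ?b (levels m P). j < i}) =
      q_int q ((int p + 1 - int j) * int m) * (of_bool (Suc p \<in> levels m P) * q ^ inv_number m B P) +
      q_int q (int r) * (of_bool (Suc p \<notin> levels m P) * q ^ inv_number m B P)"
    proof (cases "Suc p \<in> levels m P")
      case True
      show ?thesis
        unfolding sum_avail_used[OF m r True q] card_avail_low_used[OF P True] using True by simp
    next
      case False
      show ?thesis
        unfolding sum_avail_top[OF m r False q] using False by simp
    qed
  qed
  show ?thesis
    unfolding wsum_snoc 1 2 by (rule refl)
qed

end

section \<open>Replacing zones by formal heights\<close>

text \<open>
  Here \<open>R\<close> is the sum of the remainders of the columns of \<open>B\<close> in the current zone \<open>p\<close>,
  and \<open>c\<close> holds the formal heights of all columns but the last. A rook in the partial level occupies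
  a column that otherwise acts like one of height \<open>p * m\<close>, so it removes one of these columns.
\<close>

definition zone :: "nat \<Rightarrow> real \<Rightarrow> nat \<Rightarrow> nat list \<Rightarrow> int list \<Rightarrow> nat \<Rightarrow> bool" where
  "zone m q p B c R \<longleftrightarrow> (\<forall>k. wfree m q p k B = q ^ R * col_rook q m k (int (p * m) # c) \<and>
     wused m q p k B = (case k of 0 \<Rightarrow> 0 | Suc j \<Rightarrow> q_int q (int R) * col_rook q m j c))"

text \<open>No old column reaches level \<open>p + 1\<close>, so \<open>wused\<close> vanishes on
  \<open>B\<close> and \<open>wfree\<close> is the full sum.\<close>

lemma zone_first:
  assumes "1 \<le> m" "r \<le> m" "q \<noteq> 0" and B: "\<forall>x\<in>set B. x \<le> p * m"
    and F: "\<And>k. wsum m q k B (\<lambda>_. 1) = col_rook q m k c"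
  shows "zone m q p (B @ [p * m + r]) c r"
proof -
  have B': "\<forall>x\<in>set B. x \<le> Suc p * m" using B by (force intro: order_trans)
  have "Suc p \<notin> levels m P" if "P \<in> rook_placements m k B" for P k
    using levels_bound[OF assms(1) that B] by auto
  then have V: "wused m q p k B = 0" for k
    unfolding wsum_def by (intro sum.neutral) auto
  then have U: "wfree m q p k B = col_rook q m k c" for k
    using F[of k] wfree_plus_wused[where p = p] V by (metis add.right_neutral)
  have powr: "q powi (int r + (int p - int k) * int m) = q ^ r * q powi (int (p * m) - int k * int m)" for k
    using assms(3) by (simp add: power_int_add left_diff_distrib)
  show ?thesis
    unfolding zone_def wfree_snoc[OF assms(1-3) B'] wused_snoc[OF assms(1-3) B'] U V
    using powr by (auto simp: algebra_simps split: nat.splits)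
qed

text \<open>For \<open>wused\<close> with \<open>j + 1\<close> rooks, the exponent
  \<open>p + 1 - (j + 1) = p - j\<close> is that of a column of height \<open>p * m\<close> with
  \<open>j\<close> rooks. The remainders merge by \<open>q_int_add\<close>: [R] + q^R [r] =
  [R + r].\<close>

lemma zone_next:
  assumes "1 \<le> m" "r \<le> m" "q \<noteq> 0" and B: "\<forall>x\<in>set B. x \<le> Suc p * m"
    and Z: "zone m q p B c R"
  shows "zone m q p (B @ [p * m + r]) (int (p * m) # c) (R + r)"
proof -
  have U: "wfree m q p k B = q ^ R * col_rook q m k (int (p * m) # c)"
   and V: "wused m q p k B = (case k of 0 \<Rightarrow> 0 | Suc j \<Rightarrow> q_int q (int R) * col_rook q m j c)" for k
    using Z by (auto simp: zone_def)
  have powr: "q powi (int r + (int p - int k) * int m) = q ^ r * q powi (int (p * m) - int k * int m)" for k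
    using assms(3) by (simp add: power_int_add left_diff_distrib)
  have "wfree m q p k (B @ [p * m + r]) = q ^ (R + r) * col_rook q m k (int (p * m) # int (p * m) # c)" for k
    unfolding wfree_snoc[OF assms(1-3) B] U col_rook.simps(2)[of q m k "int (p * m)" "_ # _"]
    using powr[of k] by (auto simp: power_add algebra_simps simp del: col_rook.simps split: nat.splits)
  moreover have "wused m q p (Suc j) (B @ [p * m + r]) = q_int q (int (R + r)) * col_rook q m j (int (p * m) # c)" for j
    unfolding wused_snoc[OF assms(1-3) B] U V
    using assms(3) by (auto simp: q_int_add algebra_simps split: nat.splits)
  moreover have "wused m q p 0 (B @ [p * m + r]) = 0"
    unfolding wused_snoc[OF assms(1-3) B] V by simp
  ultimately show ?thesis
    unfolding zone_def by (auto split: nat.splits)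
qed

text \<open>A last column of formal height \<open>p * m + R\<close> splits by
  \<open>q_int_add\<close> into its top \<open>R\<close> cells, giving the \<open>wused\<close>
  part, and a column of height \<open>p * m\<close> weighted by \<open>q ^ R\<close>, giving the
  \<open>wfree\<close> part.\<close>

lemma zone_total:
  assumes "q \<noteq> 0" and "zone m q p B c R"
  shows "wsum m q k B (\<lambda>_. 1) = col_rook q m k (int (p * m + R) # c)"
proof -
  have "q_int q (int (p * m) + int R - int j * int m) =
      q_int q (int R) + q ^ R * q_int q (int (p * m) - int j * int m)" for j
    using q_int_add[OF assms(1), of "int R" "int (p * m) - int j * int m"] by (simp add: algebra_simps)
  moreover have "q powi (int (p * m) + int R - int k * int m) = q ^ R * q powi (int (p * m) - int k * int m)"
    using power_int_add[of q "int R" "int (p * m) - int k * int m"] assms(1) by (simp add: algebra_simps)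
  ultimately show ?thesis
    using assms(2) unfolding zone_def wfree_plus_wused[where p = p, symmetric]
    by (auto simp: algebra_simps split: nat.splits)
qed

text \<open>It matters that one list \<open>c\<close> works for all \<open>q\<close>: this ties the
  values at \<open>q = 1\<close> to those at other \<open>q\<close>.\<close>

lemma ex_col_rook:
  assumes m: "1 \<le> m" and "sorted B"
  shows "\<exists>c. length c = length B \<and> (\<forall>q\<ge>1. \<forall>k. wsum m q k B (\<lambda>_. 1) = col_rook q m k c)"
proof -
  let ?Z = "\<lambda>B c R. Suc (length c) = length B \<and> (\<forall>q\<ge>1. zone m q (last B div m) B c R)"
  have total: "\<exists>c. length c = length B \<and> (\<forall>q\<ge>1. \<forall>k. wsum m q k B (\<lambda>_. 1) = col_rook q m k c)"
    if "?Z B c R" for B c R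
    \<comment> \<open>Closing a zone: its last column receives the sum \<open>R\<close> of all its
      remainders.\<close>
    using that by (intro exI[of _ "int (last B div m * m + R) # c"]) (auto simp del: col_rook.simps of_nat_add of_nat_mult intro!: zone_total)
  have base: "wsum m q k [] (\<lambda>_. 1) = col_rook q m k []" for q k
  proof -
    have cells_Nil: "cells [] = {}" by (auto simp: cells_def)
    have "rook_placements m k [] = (if k = 0 then {{}} else {})"
      using cells_Nil by (auto simp: rook_placements_def)
    moreover have "inv_number m [] {} = 0" by (simp add: inv_number_def cells_Nil)
    ultimately show ?thesis by (simp add: wsum_def)
  qed
  have main: "\<exists>c R. ?Z B c R" if "sorted B" "B \<noteq> []" for B
    using that
  proof (induction B rule: rev_induct)
    case Nil
    then show ?case by simp
  next
    case (snoc b B)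
    define p r where "p = b div m" and "r = b mod m"
    have b: "b = p * m + r" and r: "r \<le> m"
      using m by (auto simp: p_def r_def intro: less_imp_le)
    have pm: "b \<le> Suc p * m" using b r by simp
    have B: "sorted B" "\<And>x. x \<in> set B \<Longrightarrow> x \<le> b" using snoc.prems by (auto simp: sorted_append)
    have le: "\<forall>x\<in>set B. x \<le> Suc p * m" using B pm by (meson order_trans)
    \<comment> \<open>Opening a zone is needed twice: for the very first column, and after an
      earlier zone has been closed.\<close>
    have first: ?case if "\<forall>x\<in>set B. x \<le> p * m"
      "length c = length B" "\<forall>q\<ge>1. \<forall>k. wsum m q k B (\<lambda>_. 1) = col_rook q m k c" for c
    proof (intro exI conjI allI impI)
      show "Suc (length c) = length (B @ [b])" using that by simp
      fix q :: real assume "q \<ge> 1"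
      then show "zone m q (last (B @ [b]) div m) (B @ [b]) c r"
        using zone_first[OF m r _ that(1), of q c] that(3) by (simp add: b[symmetric] p_def[symmetric])
    qed
    show ?case
    proof (cases "B = []")
      case True
      then show ?thesis using first[of "[]"] base by simp
    next
      case False
      then obtain c R where Z: "?Z B c R" using snoc.IH B by blast
      show ?thesis
      proof (cases "last B div m = p")
        case True
        show ?thesis
        proof (intro exI conjI allI impI)
          show "Suc (length (int (p * m) # c)) = length (B @ [b])" using Z by simp
          fix q :: real assume "q \<ge> 1"
          then show "zone m q (last (B @ [b]) div m) (B @ [b]) (int (p * m) # c) (R + r)"
            using zone_next[OF m r _ le, of q c R] Z True by (simp add: b[symmetric] p_def[symmetric])
        qed
      next
        \<comment> \<open>A new zone begins. By sortedness no old column exceeds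
          \<open>p * m\<close>, so the old zone can be closed by \<open>total\<close>.\<close>
        case neq: False
        have "last B \<le> b" using False B by simp
        then have "last B div m \<le> p" unfolding p_def by (rule div_le_mono)
        then have "last B div m < p" using neq by simp
        then have "last B < p * m" using m by (simp add: div_less_iff_less_mult)
        moreover have "x \<le> last B" if "x \<in> set B" for x
        proof -
          have "sorted (butlast B @ [last B])" "x \<in> set (butlast B @ [last B])"
            using False B(1) that by simp_all
          then show ?thesis by (auto simp: sorted_append)
        qed
        ultimately have "\<forall>x\<in>set B. x \<le> p * m" by fastforce
        then show ?thesis using total[OF Z] first by blast
      qed
    qed
  qed
  show ?thesis
  proof (cases "B = []")
    case True
    then show ?thesis using base by (intro exI[of _ "[]"]) simp
  next
    case False
    then show ?thesis using main[OF assms(2)] total by blast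
  qed
qed

section \<open>Factorization into q-integers\<close>

definition q_falling :: "real \<Rightarrow> nat \<Rightarrow> int \<Rightarrow> nat \<Rightarrow> real" where
  "q_falling q m x n = (\<Prod>l<n. q_int q (x - int l * int m))"

text \<open>As the head is the rightmost column, \<open>length c\<close> counts the columns to its
  left. At \<open>q = 1\<close> the entries are the negated roots of the product in the
  factorization.\<close>

fun rook_roots :: "nat \<Rightarrow> int list \<Rightarrow> int list" where
  "rook_roots m [] = []"
| "rook_roots m (y # c) = (y - int (length c) * int m) # rook_roots m c"

lemma col_rook_eq_0: "length c < k \<Longrightarrow> col_rook q m k c = 0"
  by (induction c arbitrary: k) (auto split: nat.splits)

text \<open>The factor of a new column of height y splits as [x + y - n m] = [y - k m] + q^(y - k m)
  [x - (n - k) m]. The first summand places a rook in that column, the second leaves it empty and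
  lengthens the falling product.\<close>

lemma col_rook_factorization:
  assumes "q \<noteq> 0"
  shows "(\<Sum>k\<le>length c. col_rook q m k c * q_falling q m x (length c - k)) =
    prod_list (map (\<lambda>d. q_int q (x + d)) (rook_roots m c))"
proof (induction c)
  case Nil
  show ?case by (simp add: q_falling_def)
next
  case (Cons y c)
  let ?n = "length c"
  have fall: "q_falling q m x (Suc ?n - k) = q_falling q m x (?n - k) * q_int q (x - int (?n - k) * int m)"
    if "k \<le> ?n" for k
    using that by (simp add: Suc_diff_le q_falling_def)
  have split: "q_int q (x + (y - int ?n * int m)) =
      q_int q (y - int k * int m) + q powi (y - int k * int m) * q_int q (x - int (?n - k) * int m)"
    if "k \<le> ?n" for k
    using q_int_add[OF assms, of "y - int k * int m" "x - int (?n - k) * int m"] that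
    by (simp add: of_nat_diff algebra_simps)
  have "(\<Sum>k\<le>Suc ?n. col_rook q m k (y # c) * q_falling q m x (Suc ?n - k)) =
      (\<Sum>k\<le>Suc ?n. q powi (y - int k * int m) * col_rook q m k c * q_falling q m x (Suc ?n - k)) +
      (\<Sum>k\<le>Suc ?n. (case k of 0 \<Rightarrow> 0 | Suc j \<Rightarrow> q_int q (y - int j * int m) * col_rook q m j c) *
         q_falling q m x (Suc ?n - k))"
    unfolding sum.distrib[symmetric] by (simp only: col_rook.simps distrib_right)
  also have "(\<Sum>k\<le>Suc ?n. q powi (y - int k * int m) * col_rook q m k c * q_falling q m x (Suc ?n - k)) =
      (\<Sum>k\<le>?n. q powi (y - int k * int m) * col_rook q m k c * q_falling q m x (Suc ?n - k))"
    \<comment> \<open>The top term would need more rooks than columns.\<close>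
    by (simp add: col_rook_eq_0)
  also have "(\<Sum>k\<le>Suc ?n. (case k of 0 \<Rightarrow> 0 | Suc j \<Rightarrow> q_int q (y - int j * int m) * col_rook q m j c) *
         q_falling q m x (Suc ?n - k)) =
      (\<Sum>k\<le>?n. q_int q (y - int k * int m) * col_rook q m k c * q_falling q m x (?n - k))"
    unfolding sum.atMost_Suc_shift by simp
  also have "(\<Sum>k\<le>?n. q powi (y - int k * int m) * col_rook q m k c * q_falling q m x (Suc ?n - k)) + \<dots> =
      (\<Sum>k\<le>?n. q_int q (x + (y - int ?n * int m)) * (col_rook q m k c * q_falling q m x (?n - k)))"
    unfolding sum.distrib[symmetric]
  proof (rule sum.cong[OF refl], goal_cases)
    case (1 k)
    then have k: "k \<le> ?n" by simp
    show ?case unfolding fall[OF k] split[OF k] by (simp add: algebra_simps)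
  qed
  also have "\<dots> = q_int q (x + (y - int ?n * int m)) *
      prod_list (map (\<lambda>d. q_int q (x + d)) (rook_roots m c))"
    unfolding sum_distrib_left[symmetric] Cons.IH ..
  finally show ?case by simp
qed

lemma q_falling_coeffs_unique:
  assumes m: "1 \<le> m" and q: "1 \<le> q"
    and eq: "\<And>x. (\<Sum>k\<le>n. a k * q_falling q m x (n - k)) = (\<Sum>k\<le>n. b k * q_falling q m x (n - k))"
    and "k \<le> n"
  shows "a k = b k"
proof -
  \<comment> \<open>Reversing the index makes it the length of the falling product, so the system
    becomes triangular.\<close>
  define d where "d i = a (n - i) - b (n - i)" for i
  have zero: "(\<Sum>i\<le>n. d i * q_falling q m x i) = 0" for x
  proof -
    have "(\<Sum>i\<le>n. d i * q_falling q m x i) = (\<Sum>k\<le>n. (a k - b k) * q_falling q m x (n - k))"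
      by (rule sum.reindex_bij_witness[of _ "\<lambda>k. n - k" "\<lambda>k. n - k"]) (auto simp: d_def)
    also have "\<dots> = 0" using eq[of x] by (simp add: left_diff_distrib sum_subtractf)
    finally show ?thesis .
  qed
  \<comment> \<open>At \<open>x = i * m\<close> the factorial products of length greater than \<open>i\<close> vanish.\<close>
  have "d i = 0" if "i \<le> n" for i
    using that
  proof (induction i rule: less_induct)
    case (less i)
    let ?x = "int i * int m"
    have "d j * q_falling q m ?x j = 0" if "j \<in> {..n} - {i}" for j
    proof (cases "j < i")
      case True
      then show ?thesis using less by simp
    next
      case False
      then have "i \<in> {..<j}" using that by auto
      moreover have "q_int q (?x - int i * int m) = 0" by simp
      ultimately have "q_falling q m ?x j = 0"
        unfolding q_falling_def by (blast intro: prod_zero)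
      then show ?thesis by simp
    qed
    then have "(\<Sum>j\<le>n. d j * q_falling q m ?x j) = d i * q_falling q m ?x i"
      using less.prems by (subst sum.remove[of _ i]) (simp_all add: sum.neutral)
    \<comment> \<open>The factors are the q-integers of \<open>(i - l) * m\<close> with
      \<open>l < i\<close>.\<close>
    moreover have "0 < q_falling q m ?x i"
      unfolding q_falling_def using m q by (intro prod_pos ballI q_int_pos) (auto simp: left_diff_distrib[symmetric])
    ultimately show ?case using zero by simp
  qed
  then have "d (n - k) = 0" by simp
  then show ?thesis using \<open>k \<le> n\<close> by (simp add: d_def)
qed

section \<open>Recovering the multiset of roots\<close>

lemma poly_prod_mset_linear:
  "poly (\<Prod>d\<in>#N. [:d, 1:]) x = (\<Prod>d\<in>#N. x + d)" for x :: int
  by (induction N) (auto simp: algebra_simps)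

text \<open>Factors are peeled off one at a time: \<open>- d\<close> is a zero of both products, so
  \<open>d\<close> occurs in \<open>N\<close> and the common linear factor cancels.\<close>

lemma prod_mset_linear_inject:
  fixes M N :: "int multiset"
  assumes "(\<Prod>d\<in>#M. [:d, 1:]) = (\<Prod>d\<in>#N. [:d, 1:])"
  shows "M = N"
  using assms
proof (induction M arbitrary: N)
  case empty
  show ?case
  proof (cases N)
    case (add e N')
    then have "poly (\<Prod>d\<in>#N. [:d, 1:]) (- e) = 0" by simp
    then show ?thesis using empty by (metis image_mset_empty poly_1 prod_mset_empty zero_neq_one)
  qed simp
next
  case (add d M)
  have "poly (\<Prod>d\<in>#add_mset d M. [:d, 1:]) (- d) = 0" by simp
  then have "(\<Prod>e\<in>#N. - d + e) = 0" unfolding add.prems poly_prod_mset_linear .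
  then have "d \<in># N" by (auto simp: prod_mset_zero_iff)
  then obtain N' where N: "N = add_mset d N'" by (meson mset_add)
  have "(\<Prod>d\<in>#M. [:d, 1:]) = (\<Prod>d\<in>#N'. [:d, 1:])"
    using add.prems unfolding N image_mset_add_mset prod_mset.add_mset
    by (subst (asm) mult_left_cancel) auto
  then show ?case using add.IH N by blast
qed

lemma col_rook_q_determined:
  assumes m: "1 \<le> m" and q: "1 \<le> q" and len: "length c = length c'"
    and eq: "\<And>k. col_rook 1 m k c = col_rook 1 m k c'"
  shows "col_rook q m k c = col_rook q m k c'"
proof -
  \<comment> \<open>At \<open>q = 1\<close> the factors are ordinary integers, so the comparison
    moves to integer polynomials, which agree at every integer \<open>x\<close>.\<close>
  have real_prod: "prod_list (map (\<lambda>d. q_int 1 (x + d)) ds) = of_int (\<Prod>d\<in>#mset ds. x + d)" for x ds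
    by (induction ds) (auto simp: q_int_def)
  have "(\<Prod>d\<in>#mset (rook_roots m c). x + d) = (\<Prod>d\<in>#mset (rook_roots m c'). x + d)" for x
    using col_rook_factorization[of 1 m c x] col_rook_factorization[of 1 m c' x] eq len
    unfolding real_prod by simp
  then have "poly (\<Prod>d\<in>#mset (rook_roots m c). [:d, 1:]) = poly (\<Prod>d\<in>#mset (rook_roots m c'). [:d, 1:])"
    unfolding fun_eq_iff poly_prod_mset_linear by blast
  then have roots: "mset (rook_roots m c) = mset (rook_roots m c')"
    unfolding poly_eq_poly_eq_iff by (rule prod_mset_linear_inject)
  have "prod_list (map (\<lambda>d. q_int q (x + d)) (rook_roots m c)) =
      prod_list (map (\<lambda>d. q_int q (x + d)) (rook_roots m c'))" for x
    using roots by (simp add: prod_mset_prod_list[symmetric])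
  then have "(\<Sum>k\<le>length c. col_rook q m k c * q_falling q m x (length c - k)) =
     (\<Sum>k\<le>length c. col_rook q m k c' * q_falling q m x (length c - k))" for x
    using col_rook_factorization[of q m c x] col_rook_factorization[of q m c' x] q len by simp
  then have "k \<le> length c \<Longrightarrow> ?thesis"
    by (rule q_falling_coeffs_unique[OF m q])
  then show ?thesis using col_rook_eq_0 len by (cases "k \<le> length c") auto
qed

section \<open>Comparison of two boards\<close>

text \<open>The zeros are the leftmost columns. A first rook placed in one of them has weight
  \<open>q_int q 0 = 0\<close>.\<close>

lemma col_rook_append_zeros: "col_rook q m k (c @ replicate n 0) = col_rook q m k c"
proof (induction c arbitrary: k)
  case Nil
  show ?case by (induction n arbitrary: k) (auto split: nat.splits)
qed (auto split: nat.splits)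

lemma wsum_eq_poly: "wsum m (of_int x) k B (\<lambda>_. 1) = of_int (poly (q_rook_number m k B) x)"
  by (simp add: wsum_def q_rook_number_def poly_sum poly_monom)

lemma wsum_1: "wsum m 1 k B (\<lambda>_. 1) = real (rook_number m k B)"
  by (simp add: wsum_def rook_number_def)

theorem theorem16:
  fixes m k :: nat and B B' :: "nat list"
  assumes "1 \<le> m"
    and "ferrers_board B" and "ferrers_board B'"
    and "rook_equivalent m B B'"
  shows "q_rook_number m k B = q_rook_number m k B'"
proof -
  obtain c where c: "\<And>q k. 1 \<le> q \<Longrightarrow> wsum m q k B (\<lambda>_. 1) = col_rook q m k c"
    using ex_col_rook[of m B] assms by (auto simp: ferrers_board_def)
  obtain c' where c': "\<And>q k. 1 \<le> q \<Longrightarrow> wsum m q k B' (\<lambda>_. 1) = col_rook q m k c'"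
    using ex_col_rook[of m B'] assms by (auto simp: ferrers_board_def)
  have one: "col_rook 1 m k c = col_rook 1 m k c'" for k
    using assms(4) c[of 1 k] c'[of 1 k] by (simp add: wsum_1 rook_equivalent_def)
  have same: "col_rook q m k c = col_rook q m k c'" if "1 \<le> q" for q k
    \<comment> \<open>Each list is padded by the length of the other, which makes the lengths
      equal.\<close>
    using col_rook_q_determined[OF assms(1) that, of "c @ replicate (length c') 0" "c' @ replicate (length c) 0" k]
    by (simp add: col_rook_append_zeros one)
  let ?d = "q_rook_number m k B - q_rook_number m k B'"
  \<comment> \<open>Integer points suffice: a polynomial with infinitely many zeros
    vanishes.\<close>
  have "poly ?d x = 0" if "1 \<le> x" for x
  proof -
    have "1 \<le> real_of_int x" using that by simp
    then have "real_of_int (poly (q_rook_number m k B) x) = real_of_int (poly (q_rook_number m k B') x)"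
      using c c' same unfolding wsum_eq_poly[symmetric] by metis
    then show ?thesis by simp
  qed
  then have "{1..} \<subseteq> {x. poly ?d x = 0}" by auto
  then have "infinite {x. poly ?d x = 0}"
    using infinite_Ici[of "1::int"] finite_subset by blast
  then show ?thesis using poly_roots_finite[of ?d] by auto
qed

end
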